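(* Let $X$ be a set, let $L_1,L_2\subset\mathcal{F}(X)$ be two families of functions, and let $f_1,f_2\in\mathcal{F}(X)$ be $L_1$-convex and $L_2$-convex respectively, with $\operatorname{dom} f_1\cap\operatorname{dom} f_2\neq\emptyset$. Assume that $$\operatorname{supp}(f_1,H_{L_1})+\operatorname{supp}(f_2,H_{L_2})=\operatorname{supp}(f_1+f_2,H_{L_1}+H_{L_2}).$$ Then for all $x\in\operatorname{dom} f_1\cap\operatorname{dom} f_2$, $$\partial_{L_1+L_2}(f_1+f_2)(x)=\partial_{L_1}f_1(x)+\partial_{L_2}f_2(x).$$
   Context: $\mathcal{F}(X)$ is the set of all functions $f:X\to\mathbb{R}\cup\{+\infty\}$ together with the function identically $-\infty$. Families $L$ of elementary functions consist of real-valued functions on $X$. $\operatorname{dom} f=\{x\in X: f(x)\in\mathbb{R}\}$. A function $f$ is $L$-convex if it is the pointwise supremum of some subset of $L$. For a family $L$, $H_L=\{l-c: l\in L, c\in\mathbb{R}\}$ is the set of abstract affine functions. The abstract affine function $l-c$ is identified with the pair $(l,c)$, so $H_L$ is regarded as $L\times\mathbb{R}$ and $\operatorname{supp}(f,H_L)=\{(l,c)\in L\times\mathbb{R}: l(y)-c\le f(y)\ \forall y\in X\}$. Sums are taken componentwise: $L_1+L_2=\{l_1+l_2: l_i\in L_i\}$ (pointwise sums of functions), $H_{L_1}+H_{L_2}=H_{L_1+L_2}\cong(L_1+L_2)\times\mathbb{R}$, and sums of sets are Minkowski sums. The $L$-subdifferential of $f$ at $x$ is $\partial_L f(x)=\{l\in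 L: f(y)\ge f(x)+l(y)-l(x)\ \forall y\in X\}$. *)

theory Defs
  imports
    "HOL-Library.Extended_Real"
    "HOL-Library.Function_Algebras"
    "HOL-Library.Product_Plus"
    "HOL-Library.Set_Algebras"
begin

text \<open>
  The ground set \<open>X\<close> is the universe of the type \<open>'a\<close>. Sums of functions are pointwise, sums
  of pairs componentwise, and sums of sets Minkowski sums, by the library instances of \<open>plus\<close>.
\<close>

definition ext_funs :: "('a \<Rightarrow> ereal) set" where
  "ext_funs = {f. \<forall>x. f x \<noteq> -\<infinity>} \<union> {\<lambda>x. -\<infinity>}"

definition eff_dom :: "('a \<Rightarrow> ereal) \<Rightarrow> 'a set" where
  "eff_dom f = {x. f x \<in> range ereal}"

text \<open>
  The subset \<open>U\<close> may be empty; the supremum is then identically \<open>-\<infinity>\<close>.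
\<close>

definition L_convex :: "('a \<Rightarrow> real) set \<Rightarrow> ('a \<Rightarrow> ereal) \<Rightarrow> bool" where
  "L_convex L f \<longleftrightarrow> (\<exists>U\<subseteq>L. \<forall>x. f x = (SUP l\<in>U. ereal (l x)))"

text \<open>
  The abstract affine function \<open>\<lambda>x. l x - c\<close> is represented by the pair \<open>(l, c)\<close>; two distinct
  pairs are distinct elements even if they give rise to the same function.
\<close>

definition abs_affine :: "('a \<Rightarrow> real) set \<Rightarrow> (('a \<Rightarrow> real) \<times> real) set" where
  "abs_affine L = L \<times> UNIV"

definition supp ::
    "('a \<Rightarrow> ereal) \<Rightarrow> (('a \<Rightarrow> real) \<times> real) set \<Rightarrow> (('a \<Rightarrow> real) \<times> real) set" where
  "supp f H = {(l, c) \<in> H. \<forall>y. ereal (l y - c) \<le> f y}"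

definition subdifferential ::
    "('a \<Rightarrow> real) set \<Rightarrow> ('a \<Rightarrow> ereal) \<Rightarrow> 'a \<Rightarrow> ('a \<Rightarrow> real) set" where
  "subdifferential L f x = {l \<in> L. \<forall>y. f y \<ge> f x + ereal (l y) - ereal (l x)}"

lemma abs_affine_plus: "abs_affine L1 + abs_affine L2 = abs_affine (L1 + L2)"
proof (intro equalityI subsetI)
  fix p assume "p \<in> abs_affine L1 + abs_affine L2"
  then show "p \<in> abs_affine (L1 + L2)"
    by (auto simp: abs_affine_def elim!: set_plus_elim)
next
  fix p assume "p \<in> abs_affine (L1 + L2)"
  then obtain l1 l2 c where "p = (l1 + l2, c)" "l1 \<in> L1" "l2 \<in> L2"
    by (auto simp: abs_affine_def elim!: set_plus_elim)
  then have "p = (l1, c) + (l2, 0)" "(l1, c) \<in> abs_affine L1" "(l2, 0) \<in> abs_affine L2"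
    by (auto simp: abs_affine_def)
  then show "p \<in> abs_affine L1 + abs_affine L2"
    by (metis set_plus_intro)
qed

end

theory Submission
  imports Defs
begin

text \<open>
  At a point where \<open>f x\<close> is finite, \<open>l\<close> is a subgradient of \<open>f\<close> at \<open>x\<close> iff the abstract affine
  function with slope \<open>l\<close> that touches \<open>f\<close> at \<open>x\<close> supports \<open>f\<close>. A support of \<open>f1 + f2\<close> that
  touches at \<open>x\<close> splits, by the additivity of supports, into supports of \<open>f1\<close> and \<open>f2\<close>, and these
  must then touch at \<open>x\<close> as well.
\<close>

text \<open>With \<open>f x\<close> the real number \<open>a\<close>, the subgradient inequality at
  \<open>y\<close> regroups to \<open>l y - (l x - a) \<le> f y\<close>; only \<open>f y\<close> can
  be infinite, and it stands alone on its side.\<close>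

lemma subdifferential_iff_supp:
  assumes "f x = ereal a"
  shows "l \<in> subdifferential L f x \<longleftrightarrow> (l, l x - a) \<in> supp f (abs_affine L)"
  using assms by (simp add: subdifferential_def supp_def abs_affine_def algebra_simps)

theorem theorem2:
  fixes L1 L2 :: "('a \<Rightarrow> real) set" and f1 f2 :: "'a \<Rightarrow> ereal"
  assumes "f1 \<in> ext_funs" and "f2 \<in> ext_funs"
    and "L_convex L1 f1" and "L_convex L2 f2"
    and "eff_dom f1 \<inter> eff_dom f2 \<noteq> {}"
    and "supp f1 (abs_affine L1) + supp f2 (abs_affine L2)
           = supp (f1 + f2) (abs_affine L1 + abs_affine L2)"
  shows "\<forall>x \<in> eff_dom f1 \<inter> eff_dom f2.
           subdifferential (L1 + L2) (f1 + f2) x = subdifferential L1 f1 x + subdifferential L2 f2 x"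
proof
  fix x assume "x \<in> eff_dom f1 \<inter> eff_dom f2"
  then obtain a1 a2 where a: "f1 x = ereal a1" "f2 x = ereal a2"
    by (auto simp only: eff_dom_def)
  then have a12: "(f1 + f2) x = ereal (a1 + a2)"
    by simp
  note sum_iff = subdifferential_iff_supp[where f = "f1 + f2" and x = x, OF a12]
  have supp_sum: "supp f1 (abs_affine L1) + supp f2 (abs_affine L2)
      = supp (f1 + f2) (abs_affine (L1 + L2))"
    using assms(6) by (simp only: abs_affine_plus)
  show "subdifferential (L1 + L2) (f1 + f2) x = subdifferential L1 f1 x + subdifferential L2 f2 x"
  proof (intro equalityI subsetI)
    fix l assume "l \<in> subdifferential (L1 + L2) (f1 + f2) x"
    then have "(l, l x - (a1 + a2)) \<in> supp f1 (abs_affine L1) + supp f2 (abs_affine L2)"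
      unfolding supp_sum sum_iff .
    \<comment> \<open>The splitting fixes only the sum of \<open>c1\<close> and \<open>c2\<close>;
      that each is the touching constant at \<open>x\<close> is still to be shown.\<close>
    then obtain l1 c1 l2 c2
      where s1: "(l1, c1) \<in> supp f1 (abs_affine L1)" and s2: "(l2, c2) \<in> supp f2 (abs_affine L2)"
        and l: "l = l1 + l2" and c: "l x - (a1 + a2) = c1 + c2"
      by (auto elim!: set_plus_elim)
    have "ereal (l1 x - c1) \<le> f1 x" "ereal (l2 x - c2) \<le> f2 x"
      using s1 s2 by (auto simp: supp_def)
    then have "l1 x - c1 \<le> a1" "l2 x - c2 \<le> a2"
      by (simp_all add: a)
    \<comment> \<open>The two inequalities add up to an equality, so both are tight.\<close>
    moreover have "(l1 x - c1) + (l2 x - c2) = a1 + a2"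
      using c by (simp add: l)
    ultimately have "c1 = l1 x - a1" "c2 = l2 x - a2"
      by linarith+
    then have "l1 \<in> subdifferential L1 f1 x" "l2 \<in> subdifferential L2 f2 x"
      using s1 s2 by (simp_all add: subdifferential_iff_supp a)
    then show "l \<in> subdifferential L1 f1 x + subdifferential L2 f2 x"
      unfolding l by (rule set_plus_intro)
  next
    fix l assume "l \<in> subdifferential L1 f1 x + subdifferential L2 f2 x"
    then obtain l1 l2 where l: "l = l1 + l2"
      and "l1 \<in> subdifferential L1 f1 x" "l2 \<in> subdifferential L2 f2 x"
      by (elim set_plus_elim)
    \<comment> \<open>The touching constants at \<open>x\<close> add up to that of
      \<open>l1 + l2\<close>.\<close>
    then have "(l1, l1 x - a1) \<in> supp f1 (abs_affine L1)" "(l2, l2 x - a2) \<in> supp f2 (abs_affine L2)"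
      by (simp_all add: subdifferential_iff_supp a)
    then have "(l1, l1 x - a1) + (l2, l2 x - a2) \<in> supp (f1 + f2) (abs_affine (L1 + L2))"
      unfolding supp_sum[symmetric] by (rule set_plus_intro)
    moreover have "(l1, l1 x - a1) + (l2, l2 x - a2) = (l, l x - (a1 + a2))"
      by (simp add: l)
    ultimately show "l \<in> subdifferential (L1 + L2) (f1 + f2) x"
      by (simp only: sum_iff)
  qed
qed

end
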